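(* Let $|H\rangle$ be an $n$-qubit hypergraph state with generalized stabilizer operators $K_1,\dots,K_n$ and with $\alpha(|H\rangle)<1$, and let $W_n=\alpha(|H\rangle)\,\mathbb{I}-|H\rangle\langle H|$. For real $\beta>0$ put $\tilde W_n(\beta)=\beta\,\mathbb{I}-\sum_{i=1}^n K_i$. Then the minimum value of $\beta$ for which $\beta<n$ and there exists $C>0$ with $\tilde W_n(\beta)-C\,W_n\ge0$ (positive semidefinite) is $$\beta_n=n-2\bigl(1-\alpha(|H\rangle)\bigr),$$ which is attained with $C=2$. The operator $\tilde W_n(\beta_n)$ is an entanglement witness for genuine multipartite entanglement, detecting $|H\rangle\langle H|$ (that is, $\mathrm{Tr}[\tilde W_n(\beta_n)|H\rangle\langle H|]<0$), and its robustness parameter is $\dfrac{n-\beta_n}{n}$.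
   Context: Throughout, $n\ge 2$ is the number of qubits, with Hilbert space $(\mathbb{C}^2)^{\otimes n}$, computational basis $|x\rangle$, $x\in\{0,1\}^n$, and $|+\rangle=(|0\rangle+|1\rangle)/\sqrt2$. A hypergraph $H=(V,E)$ of order $n$ has vertex set $V=\{1,\dots,n\}$ and a set $E$ of nonempty subsets of $V$ (hyperedges). For a nonempty set $e\subseteq V$, $C^{e}$ is the controlled-$Z$ gate on the qubits in $e$ (identity on the others): the diagonal operator with $C^e|x\rangle=-|x\rangle$ if $x_j=1$ for all $j\in e$, and $C^e|x\rangle=|x\rangle$ otherwise; by convention $C^{\emptyset}=-\mathbb{I}$. The hypergraph state is $|H\rangle=\prod_{e\in E}C^{e}|+\rangle^{\otimes n}$. With $N(i)=\{e\setminus\{i\}: e\in E,\ i\in e\}$, the generalized stabilizer operators are $K_i=\sigma_x^{(i)}\prod_{e\in N(i)}C^{e}$, where $\sigma_x^{(i)}$ is the Pauli $x$ matrix on qubit $i$. For a normalized pure state $|\psi\rangle$, $\alpha(|\psi\rangle)=\max|\langle\phi^A|\langle\phi^B|\psi\rangle|^2$, the maximum being over all bipartitions of the qubits into two nonempty sets $A,B$ and all normalized pure states $|\phi^A\rangle$, $|\phi^B\rangle$ of the qubits in $A$ and $B$. Let $S_{bi}$ be the convex set of density matrices that are convex combinations of projectors onto pure biseparable states $|\phi^A\rangle|\phi^B\rangle$ (different bipartitions allowed in the same combination). A state not in $S_{bi}$ is called completely entangled. A hermitian operator $W$ is an entanglement witness for genuine multipartite entanglement if $\mathrm{Tr}[W\rho]\ge0$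 for all $\rho\in S_{bi}$ and $\mathrm{Tr}[W\rho_{ent}]<0$ for some completely entangled density matrix $\rho_{ent}$. The robustness parameter of a witness $W$ relative to $|H\rangle$ is the limit (largest) value $p^L$ such that $\mathrm{Tr}[R_pW]<0$ for all $0\le p<p^L$, where $R_p=p\,\mathbb{I}/2^n+(1-p)|H\rangle\langle H|$, $0\le p\le1$. *)

theory Defs
  imports "HOL-Analysis.Analysis"
begin

text \<open>
  The qubits, i.e. the vertices of the hypergraph, are the elements of a finite type \<open>'n\<close>, so
  the number of qubits is \<open>CARD('n)\<close>. The computational basis is indexed by the bit assignments
  \<open>'n \<Rightarrow> bool\<close>. The library norm on \<open>'n qstate\<close> is the Hilbert space norm.
\<close>

type_synonym 'n qstate = "complex ^ ('n \<Rightarrow> bool)"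
type_synonym 'n qop = "complex ^ ('n \<Rightarrow> bool) ^ ('n \<Rightarrow> bool)"

definition braket :: "complex ^ 'm \<Rightarrow> complex ^ 'm \<Rightarrow> complex" where
  "braket u v = (\<Sum>x\<in>UNIV. cnj (u $ x) * v $ x)"

definition proj :: "complex ^ 'm \<Rightarrow> complex ^ 'm ^ 'm" where
  "proj \<psi> = (\<chi> x y. \<psi> $ x * cnj (\<psi> $ y))"

definition hermitian :: "complex ^ 'm ^ 'm \<Rightarrow> bool" where
  "hermitian M \<longleftrightarrow> (\<forall>x y. M $ x $ y = cnj (M $ y $ x))"

text \<open>The form \<open>braket v (M *v v)\<close> and the trace of a product of two hermitian operators are real,
  so nothing is lost by taking real parts below.\<close>

definition psd :: "complex ^ 'm ^ 'm \<Rightarrow> bool" where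
  "psd M \<longleftrightarrow> hermitian M \<and> (\<forall>v. 0 \<le> Re (braket v (M *v v)))"

definition density :: "complex ^ 'm ^ 'm \<Rightarrow> bool" where
  "density \<rho> \<longleftrightarrow> psd \<rho> \<and> trace \<rho> = 1"

definition expval :: "complex ^ 'm ^ 'm \<Rightarrow> complex ^ 'm ^ 'm \<Rightarrow> real" where
  "expval W \<rho> = Re (trace (W ** \<rho>))"

subsection \<open>Hypergraph states\<close>

text \<open>For \<open>e = {}\<close> the condition is vacuous, which gives minus the identity.\<close>

definition CZ :: "'n set \<Rightarrow> 'n::finite qop" where
  "CZ e = (\<chi> x y. if x = y then (if \<forall>j\<in>e. x j then -1 else 1) else 0)"

text \<open>A product of operators over a finite set. It does not depend on the order because the
  controlled-Z gates commute.\<close>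

definition CZ_prod :: "'n set set \<Rightarrow> 'n::finite qop" where
  "CZ_prod F = Finite_Set.fold (\<lambda>e M. CZ e ** M) (mat 1) F"

lemma CZ_mult: "CZ e ** M = (\<chi> x y. (if \<forall>j\<in>e. x j then -1 else 1) * M $ x $ y)"
proof -
  have "(CZ e ** M) $ x $ y = (if \<forall>j\<in>e. x j then -1 else 1) * M $ x $ y" for x y
  proof -
    have "(CZ e ** M) $ x $ y =
        (\<Sum>z\<in>UNIV. if x = z then (if \<forall>j\<in>e. x j then -1 else 1) * M $ z $ y else 0)"
      unfolding matrix_matrix_mult_def CZ_def vec_lambda_beta by (rule sum.cong) simp_all
    then show ?thesis by simp
  qed
  then show ?thesis by (simp add: vec_eq_iff)
qed

lemma comp_fun_commute_CZ: "comp_fun_commute (\<lambda>e M. CZ e ** M)"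
  by standard (simp add: CZ_mult fun_eq_iff vec_eq_iff)

lemma CZ_prod_empty [simp]: "CZ_prod {} = mat 1"
  by (simp add: CZ_prod_def)

lemma CZ_prod_insert: "e \<notin> F \<Longrightarrow> CZ_prod (insert e F) = CZ e ** CZ_prod F"
  unfolding CZ_prod_def
  by (rule comp_fun_commute_on.fold_insert[OF comp_fun_commute_CZ[unfolded comp_fun_commute_def']]) auto

text \<open>The uniform superposition, with \<open>plus_amp\<close> the amplitudes of one qubit.\<close>

definition plus_amp :: "bool \<Rightarrow> complex" where
  "plus_amp b = 1 / complex_of_real (sqrt 2)"

definition plus_state :: "'n::finite qstate" where
  "plus_state = (\<chi> x. \<Prod>j\<in>UNIV. plus_amp (x j))"

definition hypergraph :: "'n set set \<Rightarrow> bool" where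
  "hypergraph E \<longleftrightarrow> {} \<notin> E"

definition hypergraph_state :: "'n set set \<Rightarrow> 'n::finite qstate" where
  "hypergraph_state E = CZ_prod E *v plus_state"

definition nbhd :: "'n set set \<Rightarrow> 'n \<Rightarrow> 'n set set" where
  "nbhd E i = {e - {i} |e. e \<in> E \<and> i \<in> e}"

definition sigma_x :: "'n \<Rightarrow> 'n::finite qop" where
  "sigma_x i = (\<chi> x y. if x = y(i := \<not> y i) then 1 else 0)"

definition stab :: "'n set set \<Rightarrow> 'n \<Rightarrow> 'n::finite qop" where
  "stab E i = sigma_x i ** CZ_prod (nbhd E i)"

subsection \<open>Biseparable states\<close>

text \<open>The computational basis of the qubits in \<open>A\<close>: assignments that are \<open>undefined\<close> off \<open>A\<close>.\<close>

definition bits :: "'n set \<Rightarrow> ('n \<Rightarrow> bool) set" where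
  "bits A = (\<Pi>\<^sub>E j\<in>A. UNIV)"

text \<open>A state of the qubits in \<open>A\<close> is given by its amplitudes on \<open>bits A\<close>; values elsewhere are
  irrelevant.\<close>

definition normalized_on :: "'n set \<Rightarrow> (('n \<Rightarrow> bool) \<Rightarrow> complex) \<Rightarrow> bool" where
  "normalized_on A \<phi> \<longleftrightarrow> (\<Sum>a\<in>bits A. (cmod (\<phi> a))\<^sup>2) = 1"

definition tensor :: "'n set \<Rightarrow> 'n set \<Rightarrow> (('n \<Rightarrow> bool) \<Rightarrow> complex) \<Rightarrow> (('n \<Rightarrow> bool) \<Rightarrow> complex)
    \<Rightarrow> 'n::finite qstate" where
  "tensor A B \<phi> \<chi>' = (\<chi> x. \<phi> (restrict x A) * \<chi>' (restrict x B))"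

definition bipartition :: "'n set \<Rightarrow> 'n set \<Rightarrow> bool" where
  "bipartition A B \<longleftrightarrow> A \<noteq> {} \<and> B \<noteq> {} \<and> A \<inter> B = {} \<and> A \<union> B = UNIV"

definition pure_bisep :: "'n::finite qstate set" where
  "pure_bisep = {tensor A B \<phi> \<chi>' |A B \<phi> \<chi>'.
     bipartition A B \<and> normalized_on A \<phi> \<and> normalized_on B \<chi>'}"

definition overlaps :: "'n::finite qstate \<Rightarrow> real set" where
  "overlaps \<psi> = {(cmod (braket \<phi> \<psi>))\<^sup>2 |\<phi>. \<phi> \<in> pure_bisep}"

definition alpha :: "'n::finite qstate \<Rightarrow> real" where
  "alpha \<psi> = (GREATEST a. a \<in> overlaps \<psi>)"

definition S_bi :: "'n::finite qop set" where
  "S_bi = convex hull (proj ` pure_bisep)"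

definition completely_entangled :: "'n::finite qop \<Rightarrow> bool" where
  "completely_entangled \<rho> \<longleftrightarrow> density \<rho> \<and> \<rho> \<notin> S_bi"

definition gme_witness :: "'n::finite qop \<Rightarrow> bool" where
  "gme_witness W \<longleftrightarrow> hermitian W \<and> (\<forall>\<rho>\<in>S_bi. 0 \<le> expval W \<rho>) \<and>
     (\<exists>\<rho>. completely_entangled \<rho> \<and> expval W \<rho> < 0)"

subsection \<open>The maximum defining \<open>alpha\<close> is attained\<close>

definition unit_on :: "'n set \<Rightarrow> 'n::finite qstate set" where
  "unit_on A = {u. norm u = 1 \<and> (\<forall>a. a \<notin> bits A \<longrightarrow> u $ a = 0)}"

lemma compact_unit_on: "compact (unit_on A)"
proof -
  have "closed {u :: 'a qstate. \<forall>a. a \<notin> bits A \<longrightarrow> u $ a = 0}"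
    by (intro closed_Collect_all closed_Collect_imp closed_Collect_eq continuous_intros) auto
  moreover have "compact {u :: 'a qstate. norm u = 1}"
    using compact_sphere[of "0 :: 'a qstate" 1] by (simp add: sphere_def)
  ultimately have "compact ({u :: 'a qstate. norm u = 1} \<inter>
      {u. \<forall>a. a \<notin> bits A \<longrightarrow> u $ a = 0})"
    by (rule compact_Int_closed[rotated])
  then show ?thesis by (simp add: unit_on_def Collect_conj_eq)
qed

lemma normalized_on_unit_on:
  fixes \<phi> :: "('n::finite \<Rightarrow> bool) \<Rightarrow> complex"
  assumes "normalized_on A \<phi>"
  shows "(\<chi> a. if a \<in> bits A then \<phi> a else 0) \<in> unit_on A"
proof -
  have "(norm (\<chi> a. if a \<in> bits A then \<phi> a else 0))\<^sup>2 =
      (\<Sum>a\<in>UNIV. (cmod (if a \<in> bits A then \<phi> a else 0))\<^sup>2)"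
    by (simp add: norm_vec_def L2_set_def sum_nonneg)
  also have "\<dots> = (\<Sum>a\<in>UNIV. if a \<in> bits A then (cmod (\<phi> a))\<^sup>2 else 0)"
    by (rule sum.cong) simp_all
  also have "\<dots> = 1"
    using assms by (simp add: normalized_on_def sum.If_cases)
  finally have "norm (\<chi> a. if a \<in> bits A then \<phi> a else 0) = 1"
    using power2_eq_imp_eq[OF _ norm_ge_zero, of _ 1] by simp
  then show ?thesis by (simp add: unit_on_def)
qed

lemma unit_on_normalized_on:
  assumes "u \<in> unit_on A"
  shows "normalized_on A (($) u)"
proof -
  have "(\<Sum>a\<in>bits A. (cmod (u $ a))\<^sup>2) = (\<Sum>a\<in>UNIV. (cmod (u $ a))\<^sup>2)"
    using assms by (intro sum.mono_neutral_left) (auto simp: unit_on_def)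
  also have "\<dots> = (norm u)\<^sup>2"
    by (simp add: norm_vec_def L2_set_def sum_nonneg)
  finally show ?thesis using assms by (simp add: normalized_on_def unit_on_def)
qed

lemma pure_bisep_eq:
  "(pure_bisep :: 'n::finite qstate set) = (\<Union>(A, B)\<in>{(A, B). bipartition A B}.
     (\<lambda>(u, v). tensor A B (($) u) (($) v)) ` (unit_on A \<times> unit_on B))"
  (is "_ = ?R")
proof (intro equalityI subsetI)
  fix \<psi> :: "'n qstate" assume "\<psi> \<in> pure_bisep"
  then obtain A B \<phi> \<chi>' where *: "\<psi> = tensor A B \<phi> \<chi>'" "bipartition A B"
      "normalized_on A \<phi>" "normalized_on B \<chi>'"
    unfolding pure_bisep_def by blast
  let ?u = "\<chi> a. if a \<in> bits A then \<phi> a else 0"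
  let ?v = "\<chi> a. if a \<in> bits B then \<chi>' a else 0"
  have "\<psi> = tensor A B (($) ?u) (($) ?v)"
    by (simp add: * tensor_def vec_eq_iff bits_def)
  then show "\<psi> \<in> ?R"
    using * normalized_on_unit_on[of A \<phi>] normalized_on_unit_on[of B \<chi>'] by force
next
  fix \<psi> :: "'n qstate" assume "\<psi> \<in> ?R"
  then show "\<psi> \<in> pure_bisep"
    unfolding pure_bisep_def using unit_on_normalized_on by fastforce
qed

lemma compact_pure_bisep: "compact (pure_bisep :: 'n::finite qstate set)"
  unfolding pure_bisep_eq
proof (intro compact_UN)
  show "finite {(A :: 'n set, B). bipartition A B}" by simp
  fix p :: "'n set \<times> 'n set" assume "p \<in> {(A, B). bipartition A B}"
  obtain A B where p: "p = (A, B)" by fastforce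
  have "continuous_on (unit_on A \<times> unit_on B)
      (\<lambda>(u, v). tensor A B (($) u) (($) v) :: 'n qstate)"
    unfolding tensor_def case_prod_unfold
    by (intro continuous_intros continuous_on_vec_lambda)
  then show "compact (case p of (A, B) \<Rightarrow>
      (\<lambda>(u, v). tensor A B (($) u) (($) v) :: 'n qstate) ` (unit_on A \<times> unit_on B))"
    unfolding p prod.case by (intro compact_continuous_image compact_Times compact_unit_on)
qed

lemma pure_bisep_nonempty:
  assumes "2 \<le> CARD('n::finite)"
  shows "(pure_bisep :: 'n qstate set) \<noteq> {}"
proof -
  obtain i :: 'n where True by simp
  have "UNIV \<noteq> {i}"
  proof
    assume "UNIV = {i}"
    then have "CARD('n) = card {i}" by (rule arg_cong)
    with assms show False by simp
  qed
  then have b: "bipartition {i} (UNIV - {i})" by (auto simp: bipartition_def)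
  have n: "normalized_on A (\<lambda>a. if a = (\<lambda>j\<in>A. False) then 1 else 0)" for A :: "'n set"
  proof -
    have "(\<Sum>a\<in>bits A. (cmod (if a = (\<lambda>j\<in>A. False) then 1 else 0))\<^sup>2) =
        (\<Sum>a\<in>bits A. if a = (\<lambda>j\<in>A. False) then 1 else (0 :: real))"
      by (intro sum.cong) auto
    also have "\<dots> = 1" by (simp add: sum.delta bits_def)
    finally show ?thesis by (simp add: normalized_on_def)
  qed
  show ?thesis unfolding pure_bisep_def using b n by blast
qed

lemma alpha_attained:
  fixes \<psi> :: "'n::finite qstate"
  assumes "2 \<le> CARD('n)"
  shows "alpha \<psi> \<in> overlaps \<psi>" and "\<And>a. a \<in> overlaps \<psi> \<Longrightarrow> a \<le> alpha \<psi>"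
proof -
  have o: "overlaps \<psi> = (\<lambda>\<phi>. (cmod (braket \<phi> \<psi>))\<^sup>2) ` pure_bisep"
    by (auto simp: overlaps_def)
  have "continuous_on pure_bisep (\<lambda>\<phi>. (cmod (braket \<phi> \<psi>))\<^sup>2)"
    unfolding braket_def by (intro continuous_intros)
  then have "compact (overlaps \<psi>)"
    unfolding o by (intro compact_continuous_image compact_pure_bisep)
  moreover have "overlaps \<psi> \<noteq> {}"
    unfolding o using pure_bisep_nonempty[OF assms] by simp
  ultimately obtain m where m: "m \<in> overlaps \<psi>" "\<forall>a\<in>overlaps \<psi>. a \<le> m"
    using compact_attains_sup by blast
  then have "alpha \<psi> = m"
    unfolding alpha_def by (intro Greatest_equality) auto
  with m show "alpha \<psi> \<in> overlaps \<psi>" and "\<And>a. a \<in> overlaps \<psi> \<Longrightarrow> a \<le> alpha \<psi>"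
    by auto
qed

subsection \<open>Witnesses and robustness\<close>

definition proj_witness :: "'n::finite qstate \<Rightarrow> 'n qop" where
  "proj_witness \<psi> = alpha \<psi> *\<^sub>R mat 1 - proj \<psi>"

definition stab_witness :: "'n::finite set set \<Rightarrow> real \<Rightarrow> 'n qop" where
  "stab_witness E \<beta> = \<beta> *\<^sub>R mat 1 - (\<Sum>i\<in>UNIV. stab E i)"

definition noisy :: "'n::finite qstate \<Rightarrow> real \<Rightarrow> 'n qop" where
  "noisy \<psi> p = (p / 2 ^ CARD('n)) *\<^sub>R mat 1 + (1 - p) *\<^sub>R proj \<psi>"

definition robustness :: "'n::finite qop \<Rightarrow> 'n qstate \<Rightarrow> real" where
  "robustness W \<psi> = (GREATEST q. 0 \<le> q \<and> q \<le> 1 \<and>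
     (\<forall>p. 0 \<le> p \<and> p < q \<longrightarrow> expval (noisy \<psi> p) W < 0))"

end

theory Submission
  imports Defs
begin

text \<open>
  Conjugation by the diagonal sign operator of the hypergraph turns every generalized stabilizer
  \<open>K\<^sub>i\<close> into the bit flip on qubit \<open>i\<close> and \<open>|H\<rangle>\<close> into the uniform superposition. Hence the sum of
  the \<open>K\<^sub>i\<close> has top eigenvalue \<open>n\<close>, with eigenvector \<open>|H\<rangle>\<close>, and next eigenvalue \<open>n - 2\<close>; that gap
  is the Poincare inequality on the hypercube, which holds because the commuting projections
  \<open>P\<^sub>i = (1 + X\<^sub>i) / 2\<close> satisfy \<open>1 - \<Prod>P\<^sub>i \<le> \<Sum>(1 - P\<^sub>i)\<close>. On the two eigenspaces positivity of
  \<open>\<beta> - \<Sum>K\<^sub>i - C (\<alpha> - |H\<rangle>\<langle>H|)\<close> reads \<open>\<beta> - n + C (1 - \<alpha>) \<ge> 0\<close> and \<open>\<beta> - n + 2 - C \<alpha> \<ge> 0\<close>, and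
  eliminating \<open>C\<close> gives the minimal \<open>\<beta>\<close>.
\<close>

section \<open>The Poincare inequality on the hypercube\<close>

definition flip :: "'n \<Rightarrow> ('n \<Rightarrow> bool) \<Rightarrow> ('n \<Rightarrow> bool)" where
  "flip i x = x(i := \<not> x i)"

lemma flip_flip [simp]: "flip i (flip i x) = x"
  by (auto simp: flip_def)

lemma flip_commute: "flip i (flip j x) = flip j (flip i x)"
  by (auto simp: flip_def fun_eq_iff)

lemma flip_neq [simp]: "flip i x \<noteq> x" "x \<noteq> flip i x"
  by (auto simp: flip_def fun_eq_iff)

lemma eq_flip_iff: "x = flip i y \<longleftrightarrow> y = flip i x"
  by auto

lemma sum_flip:
  fixes f :: "('n::finite \<Rightarrow> bool) \<Rightarrow> 'a::comm_monoid_add"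
  shows "(\<Sum>x\<in>UNIV. f (flip i x)) = (\<Sum>x\<in>UNIV. f x)"
  by (rule sum.reindex_bij_witness[of _ "flip i" "flip i"]) auto

text \<open>This is the projection \<open>P\<^sub>i\<close>, onto the functions that do not depend
  on bit \<open>i\<close>.\<close>

definition flip_avg :: "'n \<Rightarrow> (('n \<Rightarrow> bool) \<Rightarrow> complex) \<Rightarrow> (('n \<Rightarrow> bool) \<Rightarrow> complex)" where
  "flip_avg i w x = (w x + w (flip i x)) / 2"

definition sqn :: "(('n::finite \<Rightarrow> bool) \<Rightarrow> complex) \<Rightarrow> real" where
  "sqn w = (\<Sum>x\<in>UNIV. (cmod (w x))\<^sup>2)"

lemma sqn_nonneg: "0 \<le> sqn w"
  by (simp add: sqn_def sum_nonneg)

lemma cmod_half_parallelogram: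
  "(cmod ((a + b) / 2))\<^sup>2 + (cmod (a - (a + b) / 2))\<^sup>2 = ((cmod a)\<^sup>2 + (cmod b)\<^sup>2) / 2"
proof -
  have "a - (a + b) / 2 = (a - b) / 2" by (simp add: field_simps)
  then show ?thesis
    by (simp add: norm_divide power_divide cmod_power2) (simp add: power2_eq_square algebra_simps add_divide_distrib)
qed

text \<open>Pythagoras for the projection: sum the pointwise parallelogram identity and reindex the
  flipped terms.\<close>

lemma sqn_flip_avg: "sqn (flip_avg i w) + sqn (\<lambda>x. w x - flip_avg i w x) = sqn w"
proof -
  have "sqn (flip_avg i w) + sqn (\<lambda>x. w x - flip_avg i w x) =
      (\<Sum>x\<in>UNIV. ((cmod (w x))\<^sup>2 + (cmod (w (flip i x)))\<^sup>2) / 2)"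
    by (simp only: sqn_def flip_avg_def sum.distrib[symmetric] cmod_half_parallelogram)
  also have "\<dots> = sqn w"
    using sum_flip[of "\<lambda>x. (cmod (w x))\<^sup>2" i]
    by (simp add: sqn_def sum_divide_distrib[symmetric] sum.distrib)
  finally show ?thesis .
qed

lemma sqn_flip_avg_le: "sqn (flip_avg i w) \<le> sqn w"
  using sqn_flip_avg[of i w] sqn_nonneg[of "\<lambda>x. w x - flip_avg i w x"] by simp

lemma flip_avg_diff: "flip_avg i (\<lambda>x. v x - w x) = (\<lambda>x. flip_avg i v x - flip_avg i w x)"
  by (simp add: flip_avg_def fun_eq_iff field_simps)

lemma flip_avg_commute: "flip_avg i (flip_avg j w) = flip_avg j (flip_avg i w)"
  by (simp add: flip_avg_def fun_eq_iff field_simps flip_commute[of i j])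

lemma sum_flip_avg: "(\<Sum>x\<in>UNIV. flip_avg i w x) = (\<Sum>x\<in>UNIV. w (x :: 'n::finite \<Rightarrow> bool))"
  using sum_flip[of w i] by (simp add: flip_avg_def sum_divide_distrib[symmetric] sum.distrib)

section \<open>Averaging over several coordinates\<close>

abbreviation flip_avgs :: "'n list \<Rightarrow> (('n \<Rightarrow> bool) \<Rightarrow> complex) \<Rightarrow> (('n \<Rightarrow> bool) \<Rightarrow> complex)" where
  "flip_avgs l w \<equiv> foldr flip_avg l w"

lemma flip_avgs_diff: "flip_avgs l (\<lambda>x. v x - w x) = (\<lambda>x. flip_avgs l v x - flip_avgs l w x)"
  by (induction l) (simp_all add: flip_avg_diff)

lemma flip_avgs_commute: "flip_avg i (flip_avgs l w) = flip_avgs l (flip_avg i w)"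
  by (induction l) (simp_all add: flip_avg_commute[of i])

lemma sqn_flip_avgs_le: "sqn (flip_avgs l w) \<le> sqn w"
  by (induction l) (auto intro: order_trans[OF sqn_flip_avg_le])

lemma sum_flip_avgs: "(\<Sum>x\<in>UNIV. flip_avgs l w x) = (\<Sum>x\<in>UNIV. w (x :: 'n::finite \<Rightarrow> bool))"
  by (induction l) (simp_all add: sum_flip_avg)

text \<open>Telescoping: one more projection loses the squared norm of \<open>1 - P\<^sub>i\<close>
  applied to the averaged function. As \<open>P\<^sub>i\<close> commutes with the earlier averages,
  which are contractions, this is at most the loss on \<open>w\<close> itself.\<close>

lemma sqn_minus_flip_avgs_le:
  "sqn w - sqn (flip_avgs l w) \<le> (\<Sum>i\<leftarrow>l. sqn (\<lambda>x. w x - flip_avg i w x))"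
proof (induction l)
  case (Cons i l)
  have "sqn (flip_avgs l w) - sqn (flip_avg i (flip_avgs l w)) =
      sqn (\<lambda>x. flip_avgs l w x - flip_avg i (flip_avgs l w) x)"
    using sqn_flip_avg[of i "flip_avgs l w"] by simp
  also have "\<dots> = sqn (flip_avgs l (\<lambda>x. w x - flip_avg i w x))"
    by (simp add: flip_avgs_commute flip_avgs_diff)
  also have "\<dots> \<le> sqn (\<lambda>x. w x - flip_avg i w x)"
    by (rule sqn_flip_avgs_le)
  finally show ?case using Cons by simp
qed simp

text \<open>Flips connect any two vertices of the hypercube; the induction runs over the set of
  positions where they differ.\<close>

lemma flip_invariant_const:
  fixes f :: "('n::finite \<Rightarrow> bool) \<Rightarrow> 'a"
  assumes "\<And>i x. f (flip i x) = f x"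
  shows "f x = f y"
proof -
  have "\<forall>x. {j. x j \<noteq> y j} = A \<longrightarrow> f x = f y" if "finite A" for A
    using that
  proof induction
    case empty
    have "x = y" if "{j. x j \<noteq> y j} = {}" for x
      using that by (auto simp: fun_eq_iff)
    then show ?case by blast
  next
    case (insert i A)
    show ?case
    proof (intro allI impI)
      fix x assume x: "{j. x j \<noteq> y j} = insert i A"
      then have "{j. flip i x j \<noteq> y j} = A"
        using insert(2) by (auto simp: flip_def)
      then have "f (flip i x) = f y" using insert.IH by blast
      then show "f x = f y" by (simp only: assms)
    qed
  qed
  from this[OF finite] show ?thesis by blast
qed

lemma flip_avg_idem: "flip_avg i (flip_avg i w) = flip_avg i w"
  by (simp add: flip_avg_def fun_eq_iff field_simps)

lemma flip_avgs_absorb: "i \<in> set l \<Longrightarrow> flip_avg i (flip_avgs l w) = flip_avgs l w"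
  by (induction l) (auto simp: flip_avg_idem flip_avg_commute[of i])

lemma card_bits: "CARD('n::finite \<Rightarrow> bool) = 2 ^ CARD('n)"
  by (simp add: card_fun)

text \<open>Averaging over every coordinate leaves a function invariant under all flips, hence
  constant. Averages preserve the total sum, which fixes the constant.\<close>

lemma flip_avgs_const:
  fixes w :: "('n::finite \<Rightarrow> bool) \<Rightarrow> complex"
  assumes "set l = UNIV"
  shows "flip_avgs l w x = (\<Sum>y\<in>UNIV. w y) / 2 ^ CARD('n)"
proof -
  have inv: "flip_avgs l w (flip i y) = flip_avgs l w y" for i y
  proof -
    have "flip_avgs l w = flip_avg i (flip_avgs l w)"
      using assms by (simp add: flip_avgs_absorb)
    then show ?thesis
      by (metis (no_types, lifting) add.commute flip_avg_def flip_flip)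
  qed
  have "(\<Sum>y\<in>UNIV. w y) = (\<Sum>y\<in>UNIV. flip_avgs l w y)"
    by (simp add: sum_flip_avgs)
  also have "\<dots> = (\<Sum>y\<in>(UNIV :: ('n \<Rightarrow> bool) set). flip_avgs l w x)"
    by (rule sum.cong[OF refl flip_invariant_const[of "flip_avgs l w", OF inv]])
  finally show ?thesis by (simp add: card_bits)
qed

text \<open>The quadratic form of the sum of all bit flips.\<close>

definition flip_corr :: "(('n::finite \<Rightarrow> bool) \<Rightarrow> complex) \<Rightarrow> real" where
  "flip_corr w = (\<Sum>i\<in>UNIV. \<Sum>x\<in>UNIV. Re (cnj (w x) * w (flip i x)))"

text \<open>Since \<open>1 - P\<^sub>i\<close> is a projection equal to half of
  \<open>1 - X\<^sub>i\<close>, twice its quadratic form is that of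
  \<open>1 - X\<^sub>i\<close>.\<close>

lemma sqn_minus_flip_avg:
  "2 * sqn (\<lambda>x. w x - flip_avg i w x) = sqn w - (\<Sum>x\<in>UNIV. Re (cnj (w x) * w (flip i x)))"
proof -
  have *: "2 * (cmod (a - (a + b) / 2))\<^sup>2 = ((cmod a)\<^sup>2 + (cmod b)\<^sup>2) / 2 - Re (cnj a * b)" for a b
  proof -
    have "a - (a + b) / 2 = (a - b) / 2" by (simp add: field_simps)
    then show ?thesis
      by (simp add: norm_divide power_divide cmod_power2)
         (simp add: power2_eq_square algebra_simps add_divide_distrib)
  qed
  show ?thesis
    using sum_flip[of "\<lambda>x. (cmod (w x))\<^sup>2" i]
    by (simp only: sqn_def flip_avg_def sum_distrib_left * sum_subtractf sum.distrib
        sum_divide_distrib[symmetric]) simp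
qed

lemma hypercube_poincare:
  fixes w :: "('n::finite \<Rightarrow> bool) \<Rightarrow> complex"
  shows "2 * (sqn w - (cmod (\<Sum>x\<in>UNIV. w x))\<^sup>2 / 2 ^ CARD('n)) \<le> real CARD('n) * sqn w - flip_corr w"
proof -
  obtain l where l: "set l = (UNIV :: 'n set)" "distinct l"
    using finite_distinct_list[of "UNIV :: 'n set"] by auto
  \<comment> \<open>The product of all \<open>P\<^sub>i\<close> projects onto the constants, so its
    squared norm is the subtracted term.\<close>
  have "sqn (flip_avgs l w) = (cmod (\<Sum>x\<in>UNIV. w x))\<^sup>2 / 2 ^ CARD('n)"
    by (simp add: sqn_def flip_avgs_const[OF l(1)] card_bits norm_divide norm_power power2_eq_square)
  then have "2 * (sqn w - (cmod (\<Sum>x\<in>UNIV. w x))\<^sup>2 / 2 ^ CARD('n)) \<le>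
      2 * (\<Sum>i\<leftarrow>l. sqn (\<lambda>x. w x - flip_avg i w x))"
    using sqn_minus_flip_avgs_le[of w l] by simp
  also have "\<dots> = (\<Sum>i\<in>UNIV. 2 * sqn (\<lambda>x. w x - flip_avg i w x))"
    using l by (simp add: sum_list_distinct_conv_sum_set sum_distrib_left)
  also have "\<dots> = real CARD('n) * sqn w - flip_corr w"
    by (simp add: sqn_minus_flip_avg sum_subtractf flip_corr_def)
  finally show ?thesis .
qed

section \<open>Hypergraph states and stabilizers in the sign basis\<close>

definition cz_sign :: "'n set \<Rightarrow> ('n \<Rightarrow> bool) \<Rightarrow> complex" where
  "cz_sign e x = (if \<forall>j\<in>e. x j then -1 else 1)"

definition hsign :: "'n set set \<Rightarrow> ('n \<Rightarrow> bool) \<Rightarrow> complex" where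
  "hsign E x = (\<Prod>e\<in>E. cz_sign e x)"

lemma cz_sign_square [simp]: "cz_sign e x * cz_sign e x = 1"
  by (simp add: cz_sign_def)

lemma hsign_square [simp]: "hsign E x * hsign E x = 1"
  by (simp add: hsign_def prod.distrib[symmetric])

lemma hsign_square_mult [simp]: "hsign E x * (hsign E x * c) = c"
  by (simp add: mult.assoc[symmetric])

lemma cnj_hsign [simp]: "cnj (hsign E x) = hsign E x"
  by (simp add: hsign_def cz_sign_def if_distrib cong: if_cong)

lemma cmod_hsign [simp]: "cmod (hsign E x) = 1"
  by (simp add: hsign_def prod_norm[symmetric] cz_sign_def if_distrib cong: if_cong)

lemma hsign_neq_0 [simp]: "hsign E x \<noteq> 0"
  using cmod_hsign[of E x] by (metis norm_zero zero_neq_one)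

lemma CZ_prod_nth:
  fixes F :: "'n::finite set set"
  shows "CZ_prod F $ x $ y = (if x = y then hsign F x else 0)"
proof -
  have "finite F" by simp
  then show ?thesis
    by induction (auto simp: mat_def hsign_def CZ_prod_insert CZ_mult cz_sign_def)
qed

lemma hypergraph_state_nth:
  "hypergraph_state E $ (x :: 'n::finite \<Rightarrow> bool) = hsign E x / complex_of_real (sqrt 2 ^ CARD('n))"
proof -
  have "hypergraph_state E $ x = (\<Sum>y\<in>UNIV. if x = y then hsign E x * plus_state $ y else 0)"
    unfolding hypergraph_state_def matrix_vector_mult_def vec_lambda_beta
    by (rule sum.cong) (simp_all add: CZ_prod_nth)
  also have "\<dots> = hsign E x * plus_state $ x"
    by simp
  finally show ?thesis by (simp add: plus_state_def plus_amp_def power_divide)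
qed

text \<open>Hyperedges avoiding \<open>i\<close> keep their sign. For \<open>e\<close> containing
  \<open>i\<close>, the sign changes exactly when all other vertices of \<open>e\<close> carry 1,
  which is the factor of \<open>e - {i}\<close>; for \<open>e = {i}\<close> it always changes.
  Removing \<open>i\<close> is injective on these hyperedges, so no factor of
  \<open>nbhd E i\<close> is merged.\<close>

lemma hsign_flip: "hsign E (flip i x) = hsign E x * hsign (nbhd E i) (x :: 'n::finite \<Rightarrow> bool)"
proof -
  let ?N = "{e \<in> E. i \<in> e}"
  have N: "nbhd E i = (\<lambda>e. e - {i}) ` ?N"
    by (auto simp: nbhd_def)
  have inj: "inj_on (\<lambda>e. e - {i}) ?N"
    by (auto simp: inj_on_def)
  have "hsign (nbhd E i) x = (\<Prod>e\<in>?N. cz_sign (e - {i}) x)"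
    unfolding hsign_def N by (simp add: prod.reindex[OF inj])
  also have "\<dots> = (\<Prod>e\<in>E. if i \<in> e then cz_sign (e - {i}) x else 1)"
    by (simp add: prod.If_cases Int_def)
  finally have "hsign E x * hsign (nbhd E i) x =
      (\<Prod>e\<in>E. cz_sign e x * (if i \<in> e then cz_sign (e - {i}) x else 1))"
    by (simp add: hsign_def prod.distrib)
  also have "\<dots> = hsign E (flip i x)"
    unfolding hsign_def by (rule prod.cong) (auto simp: cz_sign_def flip_def)
  finally show ?thesis ..
qed

text \<open>By \<open>hsign_flip\<close> the neighbourhood sign at \<open>y\<close> is the product
  of the signs at \<open>y\<close> and \<open>flip i y\<close>, so \<open>stab E i\<close> is the
  bit flip conjugated by the diagonal sign operator.\<close>

lemma stab_nth:
  "stab E i $ x $ y = (if x = flip i y then hsign E x * hsign E y else 0)"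
proof -
  have "stab E i $ x $ y =
      (\<Sum>z\<in>UNIV. if z = y then (if x = flip i y then hsign (nbhd E i) y else 0) else 0)"
    unfolding stab_def matrix_matrix_mult_def vec_lambda_beta
    by (rule sum.cong) (auto simp: CZ_prod_nth sigma_x_def flip_def)
  then show ?thesis
    by (auto simp: hsign_flip mult_ac)
qed

lemma stab_witness_nth:
  "stab_witness E \<beta> $ x $ y = (if x = y then of_real \<beta> else 0) -
     (\<Sum>i\<in>UNIV. if x = flip i y then hsign E x * hsign E y else 0)"
  by (simp add: stab_witness_def stab_nth mat_def scaleR_conv_of_real[where 'a=complex])

lemma hermitian_stab_witness: "hermitian (stab_witness E \<beta>)"
  by (auto simp: hermitian_def stab_witness_nth eq_flip_iff[of _ _ "_ :: 'a \<Rightarrow> bool"] mult_ac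
      if_distrib intro!: arg_cong2[of _ _ _ _ "(-)"] sum.cong cong: if_cong)

text \<open>Flips have no fixed points, so the stabilizers are traceless.\<close>

lemma trace_stab_witness:
  "trace (stab_witness (E :: 'n::finite set set) \<beta>) = of_real (\<beta> * 2 ^ CARD('n))"
  by (simp add: trace_def stab_witness_nth card_bits)

text \<open>Coordinates after applying the sign operator, its own inverse; in them the stabilizers
  are plain bit flips.\<close>

definition sign_basis :: "'n set set \<Rightarrow> 'n::finite qstate \<Rightarrow> ('n \<Rightarrow> bool) \<Rightarrow> complex" where
  "sign_basis E v x = hsign E x * v $ x"

lemma sqn_sign_basis: "sqn (sign_basis E v) = (norm v)\<^sup>2"
  by (simp add: sqn_def sign_basis_def norm_mult norm_vec_def L2_set_def sum_nonneg)

section \<open>Quadratic forms of the witnesses\<close>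

lemma braket_self: "braket v v = of_real ((norm v)\<^sup>2)"
  by (simp add: braket_def norm_vec_def L2_set_def sum_nonneg complex_norm_square mult.commute
      del: of_real_power)

lemma braket_add: "braket u (v + w) = braket u v + braket u w"
  by (simp add: braket_def distrib_left sum.distrib)

lemma braket_diff: "braket u (v - w) = braket u v - braket u w"
  by (simp add: braket_def right_diff_distrib sum_subtractf)

lemma braket_scaleR: "braket u (c *\<^sub>R v) = of_real c * braket u v"
  by (simp add: braket_def sum_distrib_left scaleR_conv_of_real[where 'a=complex] mult_ac)

lemma braket_sum: "braket u (\<Sum>i\<in>A. f i) = (\<Sum>i\<in>A. braket u (f i))"
  by (induction A rule: infinite_finite_induct) (simp_all add: braket_add, simp_all add: braket_def)

lemma sum_matrix_vector_mult: "(\<Sum>i\<in>A. f i) *v v = (\<Sum>i\<in>A. f i *v (v :: complex ^ 'm))"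
  by (induction A rule: infinite_finite_induct) (simp_all add: matrix_vector_mult_add_rdistrib)

lemma scaleR_matrix_vector: "(c *\<^sub>R A) *v v = c *\<^sub>R (A *v (v :: complex ^ 'm))"
  by (simp add: vec_eq_iff matrix_vector_mult_def scaleR_sum_right)

lemma stab_mult_nth: "(stab E i *v v) $ x = hsign E x * sign_basis E v (flip i x)"
proof -
  have "(stab E i *v v) $ x = (\<Sum>y\<in>UNIV. if y = flip i x then hsign E x * hsign E y * v $ y else 0)"
    unfolding matrix_vector_mult_def vec_lambda_beta
    by (rule sum.cong) (auto simp: stab_nth eq_flip_iff[of x])
  then show ?thesis by (simp add: sign_basis_def mult_ac)
qed

lemma braket_stab_sum:
  "Re (braket v ((\<Sum>i\<in>UNIV. stab E i) *v v)) = flip_corr (sign_basis E v)"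
proof -
  have "Re (braket v (stab E i *v v)) =
      (\<Sum>x\<in>UNIV. Re (cnj (sign_basis E v x) * sign_basis E v (flip i x)))" for i
    by (simp add: braket_def stab_mult_nth sign_basis_def mult_ac del: times_complex.sel)
  then show ?thesis
    by (simp add: sum_matrix_vector_mult braket_sum flip_corr_def del: times_complex.sel)
qed

lemma braket_stab_witness:
  "Re (braket v (stab_witness E \<beta> *v v)) = \<beta> * (norm v)\<^sup>2 - flip_corr (sign_basis E v)"
  by (simp add: stab_witness_def matrix_vector_mult_diff_rdistrib braket_diff scaleR_matrix_vector
      braket_scaleR braket_self braket_stab_sum del: of_real_power)

lemma proj_mult: "proj \<psi> *v v = (\<chi> x. \<psi> $ x * braket \<psi> v)"
  by (simp add: vec_eq_iff proj_def matrix_vector_mult_def braket_def sum_distrib_left mult_ac)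

lemma braket_cnj: "braket u v = cnj (braket v u)"
  by (simp add: braket_def mult.commute)

lemma braket_proj: "braket v (proj \<psi> *v v) = of_real ((cmod (braket \<psi> v))\<^sup>2)"
proof -
  have "braket v (proj \<psi> *v v) = braket v \<psi> * braket \<psi> v"
    unfolding proj_mult by (simp add: braket_def[of v] sum_distrib_left sum_distrib_right mult_ac)
  then show ?thesis
    using braket_cnj[of v \<psi>] by (simp only: complex_norm_square mult.commute)
qed

lemma sqrt_2_power_square: "(sqrt 2 ^ n)\<^sup>2 = (2 :: real) ^ n"
  by (subst power2_eq_square) (simp flip: power_mult_distrib)

text \<open>The hypergraph state is a constant function in the sign basis, so its squared overlap is
  exactly the term subtracted in \<open>hypercube_poincare\<close>.\<close>

lemma braket_hypergraph_state:
  "(cmod (braket (hypergraph_state E) (v :: 'n::finite qstate)))\<^sup>2 =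
     (cmod (\<Sum>x\<in>UNIV. sign_basis E v x))\<^sup>2 / 2 ^ CARD('n)"
proof -
  have "braket (hypergraph_state E) v =
      (\<Sum>x\<in>UNIV. sign_basis E v x) / complex_of_real (sqrt 2 ^ CARD('n))"
    by (simp add: braket_def hypergraph_state_nth sign_basis_def sum_divide_distrib)
  then show ?thesis
    by (simp add: norm_divide norm_power power_divide sqrt_2_power_square)
qed

lemma norm_hypergraph_state: "norm (hypergraph_state E :: 'n::finite qstate) = 1"
proof -
  have "(norm (hypergraph_state E :: 'n qstate))\<^sup>2 = (\<Sum>x\<in>(UNIV :: ('n \<Rightarrow> bool) set). 1 / 2 ^ CARD('n))"
    by (simp add: norm_vec_def L2_set_def sum_nonneg hypergraph_state_nth norm_divide norm_power
        power_divide sqrt_2_power_square)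
  also have "\<dots> = 1" by (simp add: card_bits)
  finally show ?thesis
    using power2_eq_imp_eq[OF _ norm_ge_zero, of _ 1] by simp
qed

lemma sign_basis_hypergraph_state:
  "sign_basis E (hypergraph_state E :: 'n::finite qstate) = (\<lambda>x. 1 / complex_of_real (sqrt 2 ^ CARD('n)))"
  by (simp add: sign_basis_def hypergraph_state_nth fun_eq_iff)

lemma flip_corr_hypergraph_state:
  "flip_corr (sign_basis E (hypergraph_state E :: 'n::finite qstate)) = CARD('n)"
proof -
  have "sqrt 2 ^ CARD('n) * sqrt 2 ^ CARD('n) = 2 ^ CARD('n)"
    by (simp flip: power_mult_distrib)
  then show ?thesis
    unfolding sign_basis_hypergraph_state flip_corr_def
    by (simp add: card_bits Re_divide_of_real flip: of_real_mult of_real_power)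
qed

section \<open>The optimal parameter\<close>

lemma braket_witness_difference:
  fixes v :: "'n::finite qstate"
  shows "Re (braket v ((stab_witness E \<beta> - C *\<^sub>R proj_witness \<psi>) *v v)) =
     (\<beta> - C * alpha \<psi>) * (norm v)\<^sup>2 - flip_corr (sign_basis E v) + C * (cmod (braket \<psi> v))\<^sup>2"
  by (simp add: matrix_vector_mult_diff_rdistrib braket_diff scaleR_matrix_vector braket_scaleR
      proj_witness_def braket_stab_witness braket_self braket_proj
      del: of_real_power) (simp add: algebra_simps)

lemma hermitian_witness_difference: "hermitian (stab_witness E \<beta> - C *\<^sub>R proj_witness \<psi>)"
proof -
  have "proj_witness \<psi> $ x $ y = cnj (proj_witness \<psi> $ y $ x)" for x y
    by (simp add: proj_witness_def proj_def mat_def scaleR_conv_of_real[where 'a=complex])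
  moreover have "stab_witness E \<beta> $ x $ y = cnj (stab_witness E \<beta> $ y $ x)" for x y
    using hermitian_stab_witness[of E \<beta>] unfolding hermitian_def by blast
  ultimately show ?thesis
    by (metis (no_types, lifting) hermitian_def complex_cnj_diff complex_cnj_scaleR
        vector_minus_component vector_scaleR_component)
qed

text \<open>With \<open>C = 2\<close> the coefficient of the squared norm becomes
  \<open>n - 2\<close>, and positivity is \<open>hypercube_poincare\<close> rearranged.\<close>

lemma psd_witness_difference:
  fixes E :: "'n::finite set set"
  defines "H \<equiv> hypergraph_state E"
  shows "psd (stab_witness E (real CARD('n) - 2 * (1 - alpha H)) - 2 *\<^sub>R proj_witness H)"
  unfolding psd_def
proof (intro conjI allI hermitian_witness_difference)
  fix v :: "'n qstate"
  show "0 \<le> Re (braket v ((stab_witness E (real CARD('n) - 2 * (1 - alpha H)) -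
      2 *\<^sub>R proj_witness H) *v v))"
    using hypercube_poincare[of "sign_basis E v"]
    unfolding braket_witness_difference H_def braket_hypergraph_state sqn_sign_basis
    by (simp add: algebra_simps)
qed

text \<open>The eigenvector of the sum of the stabilizers for \<open>n - 2\<close>: a single-qubit Pauli \<open>z\<close> operator
  applied to the hypergraph state, up to normalization.\<close>

lemma excited_vector:
  fixes E :: "'n::finite set set" and i :: 'n
  defines "v \<equiv> (\<chi> x. hsign E x * (if x i then -1 else 1)) :: 'n qstate"
  shows "(norm v)\<^sup>2 = 2 ^ CARD('n)"
    and "flip_corr (sign_basis E v) = (real CARD('n) - 2) * 2 ^ CARD('n)"
    and "braket (hypergraph_state E) v = 0"
proof -
  let ?w = "\<lambda>x :: 'n \<Rightarrow> bool. if x i then -1 else (1 :: complex)"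
  have w: "sign_basis E v = ?w"
    by (simp add: sign_basis_def v_def fun_eq_iff)
  show "(norm v)\<^sup>2 = 2 ^ CARD('n)"
    unfolding sqn_sign_basis[of E, symmetric] w by (simp add: sqn_def if_distrib card_bits cong: if_cong)
  \<comment> \<open>Only the flip of bit \<open>i\<close> negates \<open>?w\<close>, so the flips
    contribute \<open>n - 1\<close> times 1 and once -1.\<close>
  have "cnj (?w x) * ?w (flip j x) = (if j = i then -1 else 1)" for j x
    by (auto simp: flip_def)
  then have "flip_corr ?w = (\<Sum>j\<in>UNIV. (if j = i then -1 else 1) * 2 ^ CARD('n))"
    by (auto simp: flip_corr_def card_bits simp del: times_complex.sel intro!: sum.cong)
  also have "\<dots> = (\<Sum>j\<in>UNIV. 1 - (if j = i then 2 else 0)) * 2 ^ CARD('n)"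
    unfolding sum_distrib_right by (rule sum.cong) auto
  also have "\<dots> = (real CARD('n) - 2) * 2 ^ CARD('n)"
    by (simp add: sum_subtractf)
  finally show "flip_corr (sign_basis E v) = (real CARD('n) - 2) * 2 ^ CARD('n)"
    unfolding w .
  have "(\<Sum>x\<in>UNIV. ?w x) = (\<Sum>x\<in>UNIV. ?w (flip i x))"
    by (rule sum_flip[symmetric])
  also have "\<dots> = - (\<Sum>x\<in>UNIV. ?w x)"
    unfolding sum_negf[symmetric] by (rule sum.cong) (auto simp: flip_def)
  finally have "(\<Sum>x\<in>UNIV. ?w x) = 0" by simp
  then show "braket (hypergraph_state E) v = 0"
    using braket_hypergraph_state[of E v] unfolding w by simp
qed

text \<open>Test the form on the hypergraph state and on the vector of
  \<open>excited_vector\<close>. Adding the two inequalities with weights \<open>alpha H\<close> and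
  \<open>1 - alpha H\<close> cancels \<open>C\<close>.\<close>

lemma witness_parameter_ge:
  fixes E :: "'n::finite set set"
  defines "H \<equiv> hypergraph_state E"
  assumes psd: "psd (stab_witness E \<beta> - C *\<^sub>R proj_witness H)"
    and \<alpha>: "0 \<le> alpha H" "alpha H < 1"
  shows "real CARD('n) - 2 * (1 - alpha H) \<le> \<beta>"
proof -
  have pos: "0 \<le> (\<beta> - C * alpha H) * (norm v)\<^sup>2 - flip_corr (sign_basis E v) +
      C * (cmod (braket H v))\<^sup>2" for v
    using psd unfolding psd_def braket_witness_difference by blast
  have "0 \<le> \<beta> - C * alpha H - real CARD('n) + C"
    using pos[of H] by (simp add: H_def flip_corr_hypergraph_state norm_hypergraph_state braket_self)
  then have 1: "0 \<le> alpha H * (\<beta> - C * alpha H - real CARD('n) + C)"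
    using \<alpha> by simp
  obtain i :: 'n where True by simp
  define v where "v = ((\<chi> x. hsign E x * (if x i then -1 else 1)) :: 'n qstate)"
  have "0 \<le> (\<beta> - C * alpha H - (real CARD('n) - 2)) * 2 ^ CARD('n)"
    using pos[of v] excited_vector[of E i] unfolding v_def H_def by (simp add: algebra_simps)
  then have "0 \<le> \<beta> - C * alpha H - (real CARD('n) - 2)"
    by (simp add: zero_le_mult_iff power_le_zero_eq)
  then have 2: "0 \<le> (1 - alpha H) * (\<beta> - C * alpha H - (real CARD('n) - 2))"
    using \<alpha> by simp
  show ?thesis using 1 2 by (simp add: algebra_simps)
qed

section \<open>Biseparable states\<close>

lemma norm_pure_bisep:
  assumes "\<phi> \<in> pure_bisep"
  shows "norm (\<phi> :: 'n::finite qstate) = 1"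
proof -
  obtain A B a b where \<phi>: "\<phi> = tensor A B a b" and AB: "bipartition A B"
    and n: "normalized_on A a" "normalized_on B b"
    using assms unfolding pure_bisep_def by blast
  have "(norm \<phi>)\<^sup>2 = (\<Sum>x\<in>UNIV. (cmod (a (restrict x A)))\<^sup>2 * (cmod (b (restrict x B)))\<^sup>2)"
    by (simp add: \<phi> tensor_def norm_vec_def L2_set_def sum_nonneg norm_mult power_mult_distrib)
  also have "\<dots> = (\<Sum>(y, z)\<in>bits A \<times> bits B. (cmod (a y))\<^sup>2 * (cmod (b z))\<^sup>2)"
  \<comment> \<open>A full assignment corresponds to a pair of partial ones, glued along the
    bipartition.\<close>
  proof (rule sum.reindex_bij_witness[of _ "\<lambda>(y, z) j. if j \<in> A then y j else z j"
        "\<lambda>x. (restrict x A, restrict x B)"])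
    fix x :: "'n \<Rightarrow> bool"
    show "(case (restrict x A, restrict x B) of (y, z) \<Rightarrow> \<lambda>j. if j \<in> A then y j else z j) = x"
      using AB by (auto simp: bipartition_def fun_eq_iff)
    show "(restrict x A, restrict x B) \<in> bits A \<times> bits B"
      by (simp add: bits_def)
  next
    fix p assume "p \<in> bits A \<times> bits B"
    then obtain y z where p: "p = (y, z)" "y \<in> bits A" "z \<in> bits B" by blast
    show "(restrict (case p of (y, z) \<Rightarrow> \<lambda>j. if j \<in> A then y j else z j) A,
        restrict (case p of (y, z) \<Rightarrow> \<lambda>j. if j \<in> A then y j else z j) B) = p"
      using p AB by (auto simp: bits_def bipartition_def fun_eq_iff restrict_def PiE_def extensional_def)
  qed auto
  also have "\<dots> = (\<Sum>y\<in>bits A. (cmod (a y))\<^sup>2) * (\<Sum>z\<in>bits B. (cmod (b z))\<^sup>2)"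
    by (simp add: sum_product sum.cartesian_product)
  also have "\<dots> = 1" using n by (simp add: normalized_on_def)
  finally show ?thesis
    using power2_eq_imp_eq[OF _ norm_ge_zero, of _ 1] by simp
qed

text \<open>The all-zero basis state is a product state and has nonzero amplitude in every
  hypergraph state. Strict positivity keeps the optimal parameter positive even for two
  qubits.\<close>

lemma alpha_hypergraph_state_pos:
  fixes E :: "'n::finite set set"
  assumes "2 \<le> CARD('n)"
  shows "0 < alpha (hypergraph_state E)"
proof -
  obtain i :: 'n where True by simp
  have "UNIV - {i} \<noteq> {}"
  proof
    assume "UNIV - {i} = {}"
    then have "CARD('n) \<le> card {i}" by (intro card_mono) auto
    with assms show False by simp
  qed
  then have b: "bipartition {i} (UNIV - {i})" by (auto simp: bipartition_def)
  let ?\<delta> = "\<lambda>A a. if a = (\<lambda>j\<in>A. False) then 1 else (0 :: complex)"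
  have n: "normalized_on A (?\<delta> A)" for A :: "'n set"
  proof -
    have "(\<Sum>a\<in>bits A. (cmod (?\<delta> A a))\<^sup>2) =
        (\<Sum>a\<in>bits A. if a = (\<lambda>j\<in>A. False) then 1 else 0)"
      by (intro sum.cong) auto
    also have "\<dots> = 1" by (simp add: sum.delta bits_def)
    finally show ?thesis by (simp add: normalized_on_def)
  qed
  define \<phi> :: "'n qstate" where
    "\<phi> = tensor {i} (UNIV - {i}) (?\<delta> {i}) (?\<delta> (UNIV - {i}))"
  have \<phi>: "\<phi> $ x = (if x = (\<lambda>_. False) then 1 else 0)" for x
  proof -
    have "restrict x {i} = (\<lambda>j\<in>{i}. False) \<and> restrict x (UNIV - {i}) = (\<lambda>j\<in>UNIV - {i}. False)
        \<longleftrightarrow> x = (\<lambda>_. False)"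
      by (auto simp: fun_eq_iff restrict_def)
    then show ?thesis by (auto simp: \<phi>_def tensor_def)
  qed
  have "braket \<phi> (hypergraph_state E) =
      (\<Sum>x\<in>UNIV. if x = (\<lambda>_. False) then hypergraph_state E $ x else 0)"
    unfolding braket_def by (rule sum.cong) (auto simp: \<phi>)
  also have "\<dots> \<noteq> 0"
    by (simp add: hypergraph_state_nth)
  finally have pos: "0 < (cmod (braket \<phi> (hypergraph_state E)))\<^sup>2" by simp
  have "\<phi> \<in> pure_bisep"
    unfolding pure_bisep_def \<phi>_def using b n by blast
  then have "(cmod (braket \<phi> (hypergraph_state E)))\<^sup>2 \<le> alpha (hypergraph_state E)"
    by (intro alpha_attained(2)[OF assms]) (auto simp: overlaps_def)
  with pos show ?thesis by (rule order_less_le_trans)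
qed

section \<open>Expectation values\<close>

lemma expval_commute: "expval A B = expval B A"
  by (simp only: expval_def trace_mul_sym[of A B])

lemma linear_expval: "linear (expval W)"
  by (rule linearI)
    (simp_all add: expval_def trace_def matrix_matrix_mult_def distrib_left sum.distrib
      sum_distrib_left del: times_complex.sel)

lemma expval_mat_1: "expval W (mat 1) = Re (trace W)"
  by (simp add: expval_def)

lemma expval_proj: "expval W (proj \<psi>) = Re (braket \<psi> (W *v \<psi>))"
  by (simp add: expval_def trace_def matrix_matrix_mult_def proj_def braket_def
      matrix_vector_mult_def sum_distrib_left mult_ac del: times_complex.sel)

lemma expval_stab_witness_hypergraph_state:
  "expval (stab_witness E \<beta>) (proj (hypergraph_state E :: 'n::finite qstate)) = \<beta> - real CARD('n)"
  by (simp add: expval_proj braket_stab_witness norm_hypergraph_state flip_corr_hypergraph_state)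

lemma density_proj:
  assumes "norm \<psi> = 1"
  shows "density (proj \<psi>)"
proof -
  have "trace (proj \<psi>) = braket \<psi> \<psi>"
    by (simp add: trace_def proj_def braket_def mult.commute)
  moreover have "hermitian (proj \<psi>)"
    by (simp add: hermitian_def proj_def)
  ultimately show ?thesis
    using assms by (simp add: density_def psd_def braket_proj braket_self)
qed

text \<open>The half-space of nonnegative expectation is convex and contains the generators, hence
  their hull.\<close>

lemma expval_S_bi_nonneg:
  assumes "\<And>\<phi>. \<phi> \<in> pure_bisep \<Longrightarrow> 0 \<le> expval W (proj \<phi>)" and "\<rho> \<in> S_bi"
  shows "0 \<le> expval W \<rho>"
proof -
  have "convex (expval W -` {0..})"
    by (rule convex_linear_vimage[OF linear_expval]) simp
  moreover have "proj ` pure_bisep \<subseteq> expval W -` {0..}"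
    using assms(1) by auto
  ultimately show ?thesis
    using assms(2) hull_minimal[of "proj ` pure_bisep" _ convex] unfolding S_bi_def by blast
qed

text \<open>A projector with negative expectation cannot lie in \<open>S_bi\<close>, so the detected
  state is itself the required completely entangled one.\<close>

lemma gme_witnessI:
  assumes "hermitian W" "\<And>\<phi>. \<phi> \<in> pure_bisep \<Longrightarrow> 0 \<le> expval W (proj \<phi>)"
    and "norm \<psi> = 1" "expval W (proj \<psi>) < 0"
  shows "gme_witness W"
  unfolding gme_witness_def
proof (intro conjI ballI exI)
  show "completely_entangled (proj \<psi>)"
    using assms expval_S_bi_nonneg[of W "proj \<psi>"] by (auto simp: completely_entangled_def density_proj)
qed (use assms expval_S_bi_nonneg in auto)

text \<open>The maximally mixed part contributes \<open>p * \<beta>\<close> by tracelessness of the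
  stabilizers, the pure part \<open>(1 - p) * (\<beta> - n)\<close>.\<close>

lemma expval_noisy:
  fixes E :: "'n::finite set set"
  shows "expval (noisy (hypergraph_state E) p) (stab_witness E \<beta>) =
    \<beta> - real CARD('n) + p * real CARD('n)"
proof -
  have "expval (noisy (hypergraph_state E) p) (stab_witness E \<beta>) =
      p / 2 ^ CARD('n) * Re (trace (stab_witness E \<beta>)) + (1 - p) * (\<beta> - real CARD('n))"
    by (subst expval_commute)
      (simp add: noisy_def linear_add[OF linear_expval] linear_scale[OF linear_expval]
        expval_mat_1 expval_stab_witness_hypergraph_state)
  also have "\<dots> = \<beta> - real CARD('n) + p * real CARD('n)"
    unfolding trace_stab_witness by (simp add: algebra_simps del: of_real_mult)
  finally show ?thesis .
qed

lemma robustness_stab_witness: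
  fixes E :: "'n::finite set set"
  assumes "0 \<le> \<beta>" "\<beta> \<le> real CARD('n)"
  shows "robustness (stab_witness E \<beta>) (hypergraph_state E) = (real CARD('n) - \<beta>) / real CARD('n)"
proof -
  let ?n = "real CARD('n)"
  have n: "0 < ?n" by simp
  have neg: "expval (noisy (hypergraph_state E) p) (stab_witness E \<beta>) < 0 \<longleftrightarrow> p < (?n - \<beta>) / ?n" for p
    using n by (simp add: expval_noisy field_simps)
  show ?thesis
    unfolding robustness_def neg
  proof (rule Greatest_equality)
    show "0 \<le> (?n - \<beta>) / ?n \<and> (?n - \<beta>) / ?n \<le> 1 \<and>
        (\<forall>p. 0 \<le> p \<and> p < (?n - \<beta>) / ?n \<longrightarrow> p < (?n - \<beta>) / ?n)"
      using assms n by (simp add: field_simps)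
    fix q assume "0 \<le> q \<and> q \<le> 1 \<and> (\<forall>p. 0 \<le> p \<and> p < q \<longrightarrow> p < (?n - \<beta>) / ?n)"
    moreover have "0 \<le> (?n - \<beta>) / ?n" using assms n by simp
    \<comment> \<open>A larger \<open>q\<close> would admit the threshold itself as
      \<open>p\<close>, which would then be below itself.\<close>
    ultimately show "q \<le> (?n - \<beta>) / ?n" by (meson less_irrefl not_le)
  qed
qed

theorem mainTheorem4:
  fixes E :: "'n::finite set set"
  assumes "CARD('n) \<ge> 2"
    and "hypergraph E"
    and "alpha (hypergraph_state E) < 1"
  shows
    "let n = real CARD('n);
         H = hypergraph_state E;
         \<beta>n = n - 2 * (1 - alpha H);
         S = {\<beta>::real. 0 < \<beta> \<and> \<beta> < n \<and>
                (\<exists>C>0. psd (stab_witness E \<beta> - C *\<^sub>R proj_witness H))}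
      in \<beta>n \<in> S \<and> (\<forall>\<beta>\<in>S. \<beta>n \<le> \<beta>)
         \<and> psd (stab_witness E \<beta>n - 2 *\<^sub>R proj_witness H)
         \<and> gme_witness (stab_witness E \<beta>n)
         \<and> expval (stab_witness E \<beta>n) (proj H) < 0
         \<and> robustness (stab_witness E \<beta>n) H = (n - \<beta>n) / n"
proof -
  define H where "H = hypergraph_state E"
  define \<beta> where "\<beta> = real CARD('n) - 2 * (1 - alpha H)"
  have \<alpha>: "0 < alpha H" "alpha H < 1"
    using alpha_hypergraph_state_pos[OF assms(1)] assms(3) by (simp_all add: H_def)
  have \<beta>: "0 < \<beta>" "\<beta> < real CARD('n)"
    using assms(1) \<alpha> by (simp_all add: \<beta>_def)
  have psd: "psd (stab_witness E \<beta> - 2 *\<^sub>R proj_witness H)"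
    unfolding \<beta>_def H_def by (rule psd_witness_difference)
  have detects: "expval (stab_witness E \<beta>) (proj H) < 0"
    using \<beta> by (simp add: H_def expval_stab_witness_hypergraph_state)
  have "gme_witness (stab_witness E \<beta>)"
  proof (rule gme_witnessI[OF hermitian_stab_witness _ _ detects])
    show "norm H = 1" by (simp add: H_def norm_hypergraph_state)
    fix \<phi> :: "'n qstate" assume \<phi>: "\<phi> \<in> pure_bisep"
    have "(cmod (braket \<phi> H))\<^sup>2 \<le> alpha H"
      using \<phi> by (intro alpha_attained(2)[OF assms(1)]) (auto simp: overlaps_def)
    then have "(cmod (braket H \<phi>))\<^sup>2 \<le> alpha H"
      by (subst braket_cnj) simp
    \<comment> \<open>For unit \<open>\<phi>\<close> this bounds the expectation below by twice
      \<open>alpha H\<close> minus the squared overlap with \<open>H\<close>, which is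
      nonnegative.\<close>
    moreover have "0 \<le> Re (braket \<phi> ((stab_witness E \<beta> - 2 *\<^sub>R proj_witness H) *v \<phi>))"
      using psd by (simp add: psd_def)
    ultimately show "0 \<le> expval (stab_witness E \<beta>) (proj \<phi>)"
      using norm_pure_bisep[OF \<phi>]
      by (simp add: expval_proj braket_stab_witness braket_witness_difference)
  qed
  moreover have "robustness (stab_witness E \<beta>) H = (real CARD('n) - \<beta>) / real CARD('n)"
    unfolding H_def using \<beta> by (intro robustness_stab_witness) simp_all
  moreover have "\<exists>C>0. psd (stab_witness E \<beta> - C *\<^sub>R proj_witness H)"
    using psd by (intro exI[of _ 2]) simp
  moreover have "\<beta> \<le> \<beta>'" if "psd (stab_witness E \<beta>' - C *\<^sub>R proj_witness H)" for \<beta>' C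
    using witness_parameter_ge[of E \<beta>' C] that \<alpha> by (simp add: \<beta>_def H_def)
  ultimately show ?thesis
    using \<beta> psd detects unfolding Let_def \<beta>_def H_def by blast
qed

end
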